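(* Consider a single item with starting inventory $k\in\mathbb N$ and price set $\{r^{(1)}<\dots<r^{(m)}\}$, and let $\tilde L^{(0)},\dots,\tilde L^{(m)}$ and $\tilde\Phi$ be produced by the randomized procedure described in the context. Let $c=\frac{1-e^{-\alpha^{(1)}}}{(1+k)(e^{1/k}-1)}$. Then, with probability $1$, $$k\Big(\tilde\Phi\big(\tfrac{N+1}{k}\big)-\tilde\Phi\big(\tfrac{N}{k}\big)\Big)+\tilde\Phi(\tilde L^{(j)})-\tilde\Phi\big(\tfrac Nk\big)\le\frac{r^{(j)}}{c}\quad\text{for all } j\in[m],\ N\in\{0,\dots,\tilde L^{(j)}k-1\},$$ and $\mathbb E[\tilde\Phi(\tilde L^{(j)})]\ge r^{(j)}$ for all $j\in[m]$. Furthermore, if $m=1$, these conditions hold with the improved value $c=\frac{1-e^{-\alpha^{(1)}}}{(1+k)(1-e^{-1/k})}$.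
   Context: Let $0<r^{(1)}<\dots<r^{(m)}$, $r^{(0)}=0$. Let $\alpha^{(1)},\dots,\alpha^{(m)}$ be the unique positive numbers summing to $1$ with $1-e^{-\alpha^{(1)}}=\frac{1-e^{-\alpha^{(j)}}}{1-r^{(j-1)}/r^{(j)}}$ for $j=2,\dots,m$, and $L^{(j)}=\sum_{j'=1}^j\alpha^{(j')}$ for $j=0,\dots,m$. Randomized procedure: draw $W$ uniformly from $[0,1]$; for each $j$, set $\tilde L^{(j)}=\frac{\lfloor L^{(j)}k\rfloor+1}{k}$ if $W<L^{(j)}k-\lfloor L^{(j)}k\rfloor$ and $\tilde L^{(j)}=\frac{\lfloor L^{(j)}k\rfloor}{k}$ otherwise. For $q\in\{0,\frac1k,\dots,1\}$ with $q<1$ let $\tilde\ell(q)$ be the unique $j\in[m]$ with $\tilde L^{(j-1)}\le q<\tilde L^{(j)}$, and $\tilde\ell(1)=m$. Define $$\tilde\Phi(q)=\sum_{j=1}^{\tilde\ell(q)-1}(r^{(j)}-r^{(j-1)})\frac{\exp(\tilde L^{(j)}-\tilde L^{(j-1)})-1}{\exp(\alpha^{(j)})-1}+(r^{(\tilde\ell(q))}-r^{(\tilde\ell(q)-1)})\frac{\exp(q-\tilde L^{(\tilde\ell(q)-1)})-1}{\exp(\alpha^{(\tilde\ell(q))})-1}.$$ *)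

theory Defs
  imports "HOL-Probability.Probability"
begin

text \<open>
  Prices are a function \<open>r\<close> on \<open>{0..m}\<close> with \<open>r 0 = 0\<close>; the values of \<open>r\<close> and \<open>\<alpha>\<close> at other
  indices are never used.
\<close>

definition price_set :: "nat \<Rightarrow> (nat \<Rightarrow> real) \<Rightarrow> bool" where
  "price_set m r \<longleftrightarrow> 1 \<le> m \<and> r 0 = 0 \<and> strict_mono_on {0..m} r"

text \<open>
  These conditions determine \<open>\<alpha>\<close> uniquely on \<open>{1..m}\<close>.  With \<open>t = 1 - exp (- \<alpha> 1)\<close> they force
  \<open>\<alpha> j = - ln (1 - t * (1 - r (j - 1) / r j))\<close>, and the sum of these values increases continuously
  from \<open>0\<close> to infinity as \<open>t\<close> runs through \<open>[0, 1)\<close>.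
\<close>

definition booking_fractions :: "nat \<Rightarrow> (nat \<Rightarrow> real) \<Rightarrow> (nat \<Rightarrow> real) \<Rightarrow> bool" where
  "booking_fractions m r \<alpha> \<longleftrightarrow>
     (\<forall>j\<in>{1..m}. 0 < \<alpha> j) \<and>
     (\<Sum>j=1..m. \<alpha> j) = 1 \<and>
     (\<forall>j\<in>{2..m}. 1 - exp (- \<alpha> 1) = (1 - exp (- \<alpha> j)) / (1 - r (j - 1) / r j))"

definition L :: "(nat \<Rightarrow> real) \<Rightarrow> nat \<Rightarrow> real" where
  "L \<alpha> j = (\<Sum>i=1..j. \<alpha> i)"

definition L_tilde :: "nat \<Rightarrow> (nat \<Rightarrow> real) \<Rightarrow> real \<Rightarrow> nat \<Rightarrow> real" where
  "L_tilde k \<alpha> w j =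
     (if w < L \<alpha> j * real k - of_int \<lfloor>L \<alpha> j * real k\<rfloor>
      then (of_int \<lfloor>L \<alpha> j * real k\<rfloor> + 1) / real k
      else of_int \<lfloor>L \<alpha> j * real k\<rfloor> / real k)"

text \<open>
  The next two functions are meaningful for \<open>q\<close> in the grid \<open>{0, 1/k, ..., 1}\<close> only.
\<close>

definition ell_tilde :: "nat \<Rightarrow> nat \<Rightarrow> (nat \<Rightarrow> real) \<Rightarrow> real \<Rightarrow> real \<Rightarrow> nat" where
  "ell_tilde k m \<alpha> w q =
     (if q = 1 then m
      else (THE j. j \<in> {1..m} \<and> L_tilde k \<alpha> w (j - 1) \<le> q \<and> q < L_tilde k \<alpha> w j))"

definition Phi_tilde ::
    "nat \<Rightarrow> nat \<Rightarrow> (nat \<Rightarrow> real) \<Rightarrow> (nat \<Rightarrow> real) \<Rightarrow> real \<Rightarrow> real \<Rightarrow> real" where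
  "Phi_tilde k m r \<alpha> w q =
     (let l = ell_tilde k m \<alpha> w q in
        (\<Sum>j=1..l - 1. (r j - r (j - 1)) *
            ((exp (L_tilde k \<alpha> w j - L_tilde k \<alpha> w (j - 1)) - 1) / (exp (\<alpha> j) - 1)))
        + (r l - r (l - 1)) *
            ((exp (q - L_tilde k \<alpha> w (l - 1)) - 1) / (exp (\<alpha> l) - 1)))"

text \<open>The law of the seed \<open>W\<close>.\<close>

definition seed :: "real measure" where
  "seed = uniform_measure lborel {0..1}"

definition value_function_conditions ::
    "nat \<Rightarrow> nat \<Rightarrow> (nat \<Rightarrow> real) \<Rightarrow> (nat \<Rightarrow> real) \<Rightarrow> real \<Rightarrow> bool" where
  "value_function_conditions k m r \<alpha> c \<longleftrightarrow>
     (AE W in seed. \<forall>j\<in>{1..m}. \<forall>N::nat. real N \<le> L_tilde k \<alpha> W j * real k - 1 \<longrightarrow>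
        real k * (Phi_tilde k m r \<alpha> W (real (N + 1) / real k) - Phi_tilde k m r \<alpha> W (real N / real k))
        + Phi_tilde k m r \<alpha> W (L_tilde k \<alpha> W j) - Phi_tilde k m r \<alpha> W (real N / real k)
        \<le> r j / c) \<and>
     (\<forall>j\<in>{1..m}. prob_space.expectation seed (\<lambda>W. Phi_tilde k m r \<alpha> W (L_tilde k \<alpha> W j)) \<ge> r j)"

end

theory Submission
  imports Defs
begin

text \<open>
  The condition on the booking fractions says that \<open>(r j - r (j - 1)) / (exp (\<alpha> j) - 1)\<close>, the
  coefficient in \<open>Phi_tilde\<close>, equals \<open>r j * exp (- \<alpha> j) / t\<close> with \<open>t = 1 - exp (- \<alpha> 1)\<close>.  Hence, for
  fixed \<open>N\<close>, the left-hand side of the first inequality satisfies a one-step recursion in \<open>j\<close>, which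
  starts at the interval containing \<open>N / k\<close>.  The second inequality is Jensen's inequality for \<open>exp\<close>,
  because the expectation of \<open>L_tilde k \<alpha> w j\<close> is \<open>L \<alpha> j\<close>.
\<close>

section \<open>Rounding with a common seed\<close>

lemma L_Suc: "L \<alpha> (Suc j) = L \<alpha> j + \<alpha> (Suc j)"
  by (simp add: L_def)

lemma L_tilde_eq:
  "L_tilde k \<alpha> w j =
     (of_int \<lfloor>L \<alpha> j * real k\<rfloor> + indicator {..<frac (L \<alpha> j * real k)} w) / real k"
  by (auto simp: L_tilde_def frac_def)

lemma L_tilde_mult_Ints:
  assumes "k \<ge> 1"
  shows "L_tilde k \<alpha> w j * real k \<in> \<int>"
  using assms by (auto simp: L_tilde_def)

text \<open>All limits share one seed. With equal floors the larger number has the larger fractional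
  part, so it rounds up whenever the smaller does; otherwise the smaller, even rounded up, is at
  most the larger floor.\<close>

lemma L_tilde_mono_L:
  assumes "L \<alpha> i \<le> L \<alpha> j"
  shows "L_tilde k \<alpha> w i \<le> L_tilde k \<alpha> w j"
proof -
  define a b where "a = L \<alpha> i * real k" and "b = L \<alpha> j * real k"
  have "a \<le> b" unfolding a_def b_def using assms by (simp add: mult_right_mono)
  then have "\<lfloor>a\<rfloor> = \<lfloor>b\<rfloor> \<or> \<lfloor>a\<rfloor> + 1 \<le> \<lfloor>b\<rfloor>" using floor_mono[of a b] by linarith
  then have "of_int \<lfloor>a\<rfloor> + indicator {..<frac a} w \<le> (of_int \<lfloor>b\<rfloor> + indicator {..<frac b} w :: real)"
  proof
    assume "\<lfloor>a\<rfloor> = \<lfloor>b\<rfloor>"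
    then show ?thesis using \<open>a \<le> b\<close> by (auto simp: frac_def indicator_def)
  next
    assume "\<lfloor>a\<rfloor> + 1 \<le> \<lfloor>b\<rfloor>"
    then have "real_of_int \<lfloor>a\<rfloor> + 1 \<le> real_of_int \<lfloor>b\<rfloor>" by linarith
    then show ?thesis by (auto simp: indicator_def)
  qed
  then show ?thesis unfolding L_tilde_eq a_def b_def by (rule divide_right_mono) simp
qed

text \<open>For \<open>w < 1\<close>, rounding \<open>a\<close> yields the ceiling of
  \<open>a - w\<close>, so \<open>v\<close> is the distance from \<open>a - w\<close> up to that
  integer. The shift by \<open>w\<close> is the same for every \<open>j\<close> and cancels in
  differences.\<close>

lemma L_tilde_shift_bounds:
  assumes "k \<ge> 1" "0 \<le> w" "w \<le> 1"
  shows "0 \<le> L_tilde k \<alpha> w j - L \<alpha> j + w / real k"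
    and "L_tilde k \<alpha> w j - L \<alpha> j + w / real k \<le> 1 / real k"
proof -
  define a where "a = L \<alpha> j * real k"
  define v where "v = of_int \<lfloor>a\<rfloor> + indicator {..<frac a} w - a + w"
  have k: "real k > 0" using assms by simp
  have "v = (if w < frac a then 1 - frac a + w else w - frac a)"
    by (simp add: v_def frac_def indicator_def)
  then have "0 \<le> v" "v \<le> 1"
    using assms add_increasing2[OF frac_ge_0[of a], of w 1] frac_lt_1[of a]
    by (auto simp: diff_le_eq add.commute)
  moreover have "L_tilde k \<alpha> w j - L \<alpha> j + w / real k = v / real k"
    unfolding L_tilde_eq v_def a_def using k by (simp add: field_simps)
  ultimately show "0 \<le> L_tilde k \<alpha> w j - L \<alpha> j + w / real k"
    "L_tilde k \<alpha> w j - L \<alpha> j + w / real k \<le> 1 / real k"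
    using k by (auto intro: divide_right_mono)
qed

text \<open>Serves for negative seeds, where the closed forms below do not apply.\<close>

lemma Phi_tilde_cong:
  assumes "L_tilde k \<alpha> v = L_tilde k \<alpha> w"
  shows "Phi_tilde k m r \<alpha> v = Phi_tilde k m r \<alpha> w"
  unfolding Phi_tilde_def ell_tilde_def assms ..

section \<open>Booking fractions and interval weights\<close>

locale booking =
  fixes k m :: nat and r \<alpha> :: "nat \<Rightarrow> real"
  assumes k: "k \<ge> 1"
    and price: "price_set m r"
    and fractions: "booking_fractions m r \<alpha>"
begin

abbreviation "t \<equiv> 1 - exp (- \<alpha> 1)"

lemma m: "1 \<le> m" and r_0: "r 0 = 0" and r_mono: "strict_mono_on {0..m} r"
  using price by (auto simp: price_set_def)

lemma k_pos: "real k > 0"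
  using k by simp

lemma \<alpha>_pos: "i \<in> {1..m} \<Longrightarrow> 0 < \<alpha> i"
  using fractions by (auto simp: booking_fractions_def)

lemma t_pos: "0 < t"
  using \<alpha>_pos[of 1] m by simp

lemma r_less: "i \<in> {1..m} \<Longrightarrow> r (i - 1) < r i"
  using strict_mono_onD[OF r_mono, of "i - 1" i] by auto

lemma r_pos: "i \<in> {1..m} \<Longrightarrow> 0 < r i"
  using strict_mono_onD[OF r_mono, of 0 i] r_0 by auto

text \<open>The defining equation of the fractions with denominators cleared; \<open>r 0 = 0\<close>
  extends it to \<open>i = 1\<close>.\<close>

lemma r_diff:
  assumes "i \<in> {1..m}"
  shows "t * (r i - r (i - 1)) = r i * (1 - exp (- \<alpha> i))"
proof (cases "i = 1")
  case True
  then show ?thesis by (simp add: r_0)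
next
  case False
  then have "i \<in> {2..m}" using assms by auto
  then have *: "t = (1 - exp (- \<alpha> i)) / (1 - r (i - 1) / r i)"
    using fractions unfolding booking_fractions_def by blast
  have "1 - r (i - 1) / r i \<noteq> 0" using r_less[OF assms] r_pos[OF assms] by simp
  then have "t * (1 - r (i - 1) / r i) = 1 - exp (- \<alpha> i)"
    using * nonzero_eq_divide_eq by blast
  then have "r i * (t * (1 - r (i - 1) / r i)) = r i * (1 - exp (- \<alpha> i))"
    by simp
  moreover have "r i * (t * (1 - r (i - 1) / r i)) = t * (r i - r (i - 1))"
    using r_pos[OF assms] by (simp add: field_simps)
  ultimately show ?thesis by metis
qed

definition "weight i = (r i - r (i - 1)) / (exp (\<alpha> i) - 1)"

lemma weight_nonneg: "i \<in> {1..m} \<Longrightarrow> 0 \<le> weight i"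
  unfolding weight_def using r_less[of i] \<alpha>_pos[of i] by auto

lemma weight_eq:
  assumes "i \<in> {1..m}"
  shows "t * weight i = r i * exp (- \<alpha> i)"
proof -
  have "exp (\<alpha> i) - 1 > 0" using \<alpha>_pos[OF assms] by simp
  moreover have "1 - exp (- \<alpha> i) = exp (- \<alpha> i) * (exp (\<alpha> i) - 1)"
    by (simp add: algebra_simps flip: exp_add)
  ultimately show ?thesis
    using r_diff[OF assms] unfolding weight_def by (simp add: field_simps)
qed

text \<open>Follows from \<open>r_diff\<close> because \<open>t\<close> is below 1. It passes from
  one price to the next in the induction on \<open>j\<close>.\<close>

lemma r_pred_le:
  assumes "i \<in> {1..m}"
  shows "r (i - 1) \<le> r i * exp (- \<alpha> i)"
proof -
  have "t * (r i - r (i - 1)) \<le> 1 * (r i - r (i - 1))"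
    using r_less[OF assms] by (intro mult_right_mono) auto
  then have "r i * (1 - exp (- \<alpha> i)) \<le> r i - r (i - 1)" by (simp only: r_diff[OF assms] mult_1)
  then show ?thesis by (simp add: algebra_simps)
qed

section \<open>Booking limits and the closed form of \<open>Phi_tilde\<close>\<close>

lemma L_m: "L \<alpha> m = 1"
  using fractions by (simp add: L_def booking_fractions_def)

lemma L_mono:
  assumes "i \<le> j" "j \<le> m"
  shows "L \<alpha> i \<le> L \<alpha> j"
  unfolding L_def using assms \<alpha>_pos by (intro sum_mono2) (auto intro: less_imp_le)

lemma L_tilde_mono:
  assumes "i \<le> j" "j \<le> m"
  shows "L_tilde k \<alpha> w i \<le> L_tilde k \<alpha> w j"
  using L_mono[OF assms] by (rule L_tilde_mono_L)

text \<open>Integers stay fixed only for nonnegative seeds; a negative seed would round 0 up to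
  \<open>1 / k\<close>.\<close>

lemma L_tilde_0: "0 \<le> w \<Longrightarrow> L_tilde k \<alpha> w 0 = 0"
  by (simp add: L_tilde_def L_def)

lemma L_tilde_m: "0 \<le> w \<Longrightarrow> L_tilde k \<alpha> w m = 1"
  using k by (simp add: L_tilde_def L_m)

text \<open>
  The terms with \<open>L_tilde k \<alpha> w (i - 1) \<ge> q\<close> vanish, so this expression for \<open>Phi_tilde\<close> avoids the
  case distinction in \<open>ell_tilde\<close>; in particular it is insensitive to empty intervals and to which
  of two adjacent intervals a common endpoint is assigned.
\<close>

definition "Phi_sum w q =
  (\<Sum>i=1..m. weight i * (exp (min q (L_tilde k \<alpha> w i) - min q (L_tilde k \<alpha> w (i - 1))) - 1))"

lemma Phi_sum_between:
  assumes l: "l \<in> {1..m}" and q: "L_tilde k \<alpha> w (l - 1) \<le> q" "q \<le> L_tilde k \<alpha> w l"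
  shows "Phi_sum w q =
    (\<Sum>i=1..l - 1. weight i * (exp (L_tilde k \<alpha> w i - L_tilde k \<alpha> w (i - 1)) - 1))
      + weight l * (exp (q - L_tilde k \<alpha> w (l - 1)) - 1)"
proof -
  let ?T = "L_tilde k \<alpha> w"
  let ?f = "\<lambda>i. weight i * (exp (min q (?T i) - min q (?T (i - 1))) - 1)"
  have split: "{1..m} = {1..l - 1} \<union> ({l} \<union> {l<..m})" using l by auto
  have "sum ?f {1..m} = sum ?f {1..l - 1} + (?f l + sum ?f {l<..m})"
    unfolding split by (subst sum.union_disjoint; simp?) (use l in auto)
  moreover have "sum ?f {1..l - 1} = (\<Sum>i=1..l - 1. weight i * (exp (?T i - ?T (i - 1)) - 1))"
  proof (rule sum.cong)
    fix i assume "i \<in> {1..l - 1}"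
    then have "?T i \<le> ?T (l - 1)" "?T (i - 1) \<le> ?T (l - 1)"
      using l by (auto intro!: L_tilde_mono)
    then show "?f i = weight i * (exp (?T i - ?T (i - 1)) - 1)" using q by simp
  qed simp
  moreover have "sum ?f {l<..m} = 0"
  proof (rule sum.neutral, rule ballI)
    fix i assume "i \<in> {l<..m}"
    then have "?T l \<le> ?T i" "?T l \<le> ?T (i - 1)" by (auto intro!: L_tilde_mono)
    then show "?f i = 0" using q by simp
  qed
  moreover have "?f l = weight l * (exp (q - ?T (l - 1)) - 1)" using q by simp
  ultimately show ?thesis unfolding Phi_sum_def by simp
qed

text \<open>The least index whose limit exceeds \<open>q\<close> works: it is positive because limit
  0 is 0, and at most \<open>j\<close> by leastness.\<close>

lemma ex_interval:
  assumes w: "0 \<le> w" and q: "0 \<le> q" "q < L_tilde k \<alpha> w j"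
  obtains l where "1 \<le> l" "l \<le> j" "L_tilde k \<alpha> w (l - 1) \<le> q" "q < L_tilde k \<alpha> w l"
proof -
  define l where "l = (LEAST i. q < L_tilde k \<alpha> w i)"
  have l: "q < L_tilde k \<alpha> w l" "l \<le> j"
    unfolding l_def using q by (auto intro: LeastI Least_le)
  then have "l \<noteq> 0" using L_tilde_0[OF w] q by (auto intro: Nat.gr0I)
  then have "\<not> q < L_tilde k \<alpha> w (l - 1)"
    unfolding l_def by (metis (no_types, lifting) diff_less less_numeral_extra(1) neq0_conv not_less_Least)
  then show thesis using that[of l] l \<open>l \<noteq> 0\<close> by auto
qed

text \<open>The upper bound is weak to include \<open>q = 1\<close>, which is sent to
  \<open>m\<close> by convention. Below 1, monotone limits make the half-open intervals disjoint, so
  \<open>THE\<close> is well defined.\<close>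

lemma ell_tilde_between:
  assumes w: "0 \<le> w" and q: "0 \<le> q" "q \<le> 1"
  defines "l \<equiv> ell_tilde k m \<alpha> w q"
  shows "l \<in> {1..m}" "L_tilde k \<alpha> w (l - 1) \<le> q" "q \<le> L_tilde k \<alpha> w l"
proof -
  let ?T = "L_tilde k \<alpha> w"
  have "l \<in> {1..m} \<and> ?T (l - 1) \<le> q \<and> q \<le> ?T l"
  proof (cases "q = 1")
    case True
    then show ?thesis
      using m L_tilde_m[OF w] L_tilde_mono[of "m - 1" m w] by (simp add: l_def ell_tilde_def)
  next
    case False
    let ?P = "\<lambda>j. j \<in> {1..m} \<and> ?T (j - 1) \<le> q \<and> q < ?T j"
    have "q < ?T m" using q False L_tilde_m[OF w] by simp
    then obtain j where j: "?P j" using ex_interval[OF w q(1)] by (metis atLeastAtMost_iff)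
    have no_lt: "\<not> a < b" if "?P a" "?P b" for a b
    proof
      assume "a < b"
      then have "?T a \<le> ?T (b - 1)" using that by (intro L_tilde_mono) auto
      then show False using that by auto
    qed
    have "?P (THE j. ?P j)"
      by (rule theI[where P = ?P, OF j]) (use no_lt j in \<open>metis linorder_neqE_nat\<close>)
    then show ?thesis using False by (auto simp: l_def ell_tilde_def)
  qed
  then show "l \<in> {1..m}" "?T (l - 1) \<le> q" "q \<le> ?T l" by auto
qed

lemma Phi_tilde_eq_sum:
  assumes "0 \<le> w" "0 \<le> q" "q \<le> 1"
  shows "Phi_tilde k m r \<alpha> w q = Phi_sum w q"
  unfolding Phi_sum_between[OF ell_tilde_between[OF assms]]
  by (simp add: Phi_tilde_def Let_def weight_def)

text \<open>Right endpoints can thus be evaluated on the interval they close, although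
  \<open>ell_tilde\<close> assigns those below 1 to a later interval.\<close>

lemma Phi_tilde_between:
  assumes w: "0 \<le> w" and l: "l \<in> {1..m}"
    and q: "L_tilde k \<alpha> w (l - 1) \<le> q" "q \<le> L_tilde k \<alpha> w l"
  shows "Phi_tilde k m r \<alpha> w q =
    (\<Sum>i=1..l - 1. weight i * (exp (L_tilde k \<alpha> w i - L_tilde k \<alpha> w (i - 1)) - 1))
      + weight l * (exp (q - L_tilde k \<alpha> w (l - 1)) - 1)"
proof -
  have "L_tilde k \<alpha> w 0 \<le> q" "q \<le> L_tilde k \<alpha> w m"
    using l by (auto intro: order_trans[OF L_tilde_mono q(1)] order_trans[OF q(2) L_tilde_mono])
  then have "0 \<le> q" "q \<le> 1" using L_tilde_0[OF w] L_tilde_m[OF w] by auto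
  with Phi_sum_between[OF l q] Phi_tilde_eq_sum[OF w] show ?thesis by simp
qed

lemma Phi_tilde_L_tilde:
  assumes "0 \<le> w" "j \<in> {1..m}"
  shows "Phi_tilde k m r \<alpha> w (L_tilde k \<alpha> w j) =
    (\<Sum>i=1..j. weight i * (exp (L_tilde k \<alpha> w i - L_tilde k \<alpha> w (i - 1)) - 1))"
proof -
  obtain i where "j = Suc i" using assms by (cases j) auto
  then show ?thesis
    using Phi_tilde_between[OF assms L_tilde_mono order_refl] assms by simp
qed

section \<open>Gain bound for a fixed seed\<close>

definition "gain w N j =
  real k * (Phi_tilde k m r \<alpha> w (real (N + 1) / real k) - Phi_tilde k m r \<alpha> w (real N / real k))
    + Phi_tilde k m r \<alpha> w (L_tilde k \<alpha> w j) - Phi_tilde k m r \<alpha> w (real N / real k)"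

text \<open>The value of \<open>c\<close> is \<open>t / C\<close> for a single price and
  \<open>t / (C * exp (1 / k))\<close> in general.\<close>

definition "C = (1 + real k) * (1 - exp (- (1 / real k)))"

text \<open>A rearrangement of \<open>1 + 1 / k \<le> exp (1 / k)\<close>. It makes the cross term
  in the induction on \<open>j\<close> nonnegative.\<close>

lemma C_ge_1: "1 \<le> C"
proof -
  have "1 + 1 / real k \<le> exp (1 / real k)" by (rule exp_ge_add_one_self)
  then have "exp (- (1 / real k)) \<le> 1 / (1 + 1 / real k)"
    unfolding exp_minus inverse_eq_divide by (intro frac_le) (auto intro: add_pos_nonneg)
  also have "\<dots> = real k / (1 + real k)" using k_pos by (simp add: field_simps)
  finally have "(1 + real k) * (1 - real k / (1 + real k)) \<le> C"
    unfolding C_def by (intro mult_left_mono) auto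
  then show ?thesis using k_pos by (simp add: field_simps)
qed

lemma C_exp: "C * exp (1 / real k) = (1 + real k) * (exp (1 / real k) - 1)"
  by (simp add: C_def algebra_simps flip: exp_add)

text \<open>Within one interval the gain does not decrease with the grid point, so the worst case
  lies one step \<open>y\<close> before the right end; there the bracket collapses to
  \<open>C * exp D\<close>.\<close>

lemma gain_base:
  assumes w: "0 \<le> w" and l: "l \<in> {1..m}"
    and q: "L_tilde k \<alpha> w (l - 1) \<le> real N / real k" "real N / real k < L_tilde k \<alpha> w l"
  shows "t * gain w N l \<le> r l * C * exp (L_tilde k \<alpha> w l - L_tilde k \<alpha> w (l - 1) - \<alpha> l)"
proof -
  define y q D where "y = 1 / real k" and "q = real N / real k - L_tilde k \<alpha> w (l - 1)"
    and "D = L_tilde k \<alpha> w l - L_tilde k \<alpha> w (l - 1)"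
  have next_eq: "real (N + 1) / real k = real N / real k + y"
    by (simp add: y_def add_divide_distrib)
  \<comment> \<open>Limits are multiples of \<open>1 / k\<close>, so the next grid point is still in
    the closed interval.\<close>
  obtain z where z: "L_tilde k \<alpha> w l * real k = of_int z"
    using L_tilde_mult_Ints[OF k] by (metis Ints_cases)
  have "real N < of_int z" using q(2) k_pos z by (simp add: divide_less_eq)
  then have "int N + 1 \<le> z" by linarith
  then have "real (N + 1) \<le> L_tilde k \<alpha> w l * real k" unfolding z by linarith
  then have step: "real (N + 1) / real k \<le> L_tilde k \<alpha> w l"
    using k_pos by (simp add: divide_le_eq)
  then have qy: "q + y \<le> D" unfolding next_eq q_def D_def by simp
  have "0 \<le> y" by (simp add: y_def)
  have "1 + y \<le> exp y" by (rule exp_ge_add_one_self)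
  then have ky: "0 \<le> real k * (exp y - 1) - 1"
    using k_pos by (simp add: y_def field_simps)
  note Phi = Phi_tilde_between[OF w l]
  have "gain w N l = weight l * (real k * (exp (q + y) - exp q) + (exp D - exp q))"
    unfolding gain_def Phi[OF q(1) less_imp_le[OF q(2)]]
      Phi[OF order_trans[OF q(1)] step, unfolded next_eq, OF order.refl[THEN add_increasing2[OF \<open>0 \<le> y\<close>]]]
      Phi[OF order_trans[OF q(1) less_imp_le[OF q(2)]] order.refl] next_eq
    by (simp add: q_def D_def algebra_simps)
  also have "\<dots> = weight l * ((real k * (exp y - 1) - 1) * exp q + exp D)"
    by (simp add: exp_add algebra_simps)
  also have "\<dots> \<le> weight l * ((real k * (exp y - 1) - 1) * exp (D - y) + exp D)"
    using weight_nonneg[OF l] ky qy by (intro mult_left_mono add_mono) auto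
  also have "\<dots> = weight l * (C * exp D)"
    by (simp add: C_def y_def exp_diff exp_minus field_simps)
  finally have "t * gain w N l \<le> t * (weight l * (C * exp D))"
    using t_pos by simp
  also have "\<dots> = r l * exp (- \<alpha> l) * (C * exp D)"
    using weight_eq[OF l] by (simp add: mult.assoc[symmetric])
  also have "\<dots> = r l * C * exp (D - \<alpha> l)"
    by (simp add: exp_diff exp_minus field_simps)
  finally show ?thesis unfolding D_def .
qed

text \<open>
  A single rounding error \<open>D - \<alpha> j\<close> can be as large as \<open>1 / k\<close>, so estimating the errors one by one
  would lose a factor at every step.  The rounding errors telescope, however: the shifted error
  \<open>L_tilde k \<alpha> w j - L \<alpha> j + w / k\<close> stays in \<open>[0, 1 / k]\<close>, and it is carried along the induction.
\<close>

lemma gain_le_shift: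
  assumes w: "0 \<le> w" "w \<le> 1" and l: "1 \<le> l" "l \<le> j" and j: "j \<le> m"
    and q: "L_tilde k \<alpha> w (l - 1) \<le> real N / real k" "real N / real k < L_tilde k \<alpha> w l"
  shows "t * gain w N j \<le> r j * C * exp (L_tilde k \<alpha> w j - L \<alpha> j + w / real k)"
  using l(2) j
proof (induction j rule: dec_induct)
  case base
  then have lm: "l \<in> {1..m}" using l by simp
  have "L \<alpha> l = L \<alpha> (l - 1) + \<alpha> l" using L_Suc[of \<alpha> "l - 1"] l by simp
  then have "L_tilde k \<alpha> w l - L_tilde k \<alpha> w (l - 1) - \<alpha> l
      \<le> L_tilde k \<alpha> w l - L \<alpha> l + w / real k"
    using L_tilde_shift_bounds(1)[OF k w, of \<alpha> "l - 1"] by simp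
  then have "r l * C * exp (L_tilde k \<alpha> w l - L_tilde k \<alpha> w (l - 1) - \<alpha> l)
      \<le> r l * C * exp (L_tilde k \<alpha> w l - L \<alpha> l + w / real k)"
    using r_pos[OF lm] C_ge_1 by (intro mult_left_mono) auto
  with gain_base[OF w(1) lm q] show ?case by simp
next
  case (step j)
  define u where "u = L_tilde k \<alpha> w j - L \<alpha> j + w / real k"
  define D where "D = L_tilde k \<alpha> w (Suc j) - L_tilde k \<alpha> w j"
  define a where "a = \<alpha> (Suc j)"
  have jm: "j \<in> {1..m}" "Suc j \<in> {1..m}" using step l by auto
  have IH: "t * gain w N j \<le> r j * C * exp u" unfolding u_def using step by simp
  have "0 \<le> u" unfolding u_def by (rule L_tilde_shift_bounds(1)[OF k w])
  then have "1 * 1 \<le> C * exp u" using C_ge_1 by (intro mult_mono) auto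
  moreover have "0 \<le> D" unfolding D_def using L_tilde_mono[of j "Suc j" w] step by simp
  ultimately have nonneg: "0 \<le> (C * exp u - 1) * (exp D - 1)" by simp
  \<comment> \<open>Only \<open>Phi_tilde\<close> at the \<open>j\<close>-th limit depends on
    \<open>j\<close>, so one summand is added.\<close>
  have "t * gain w N (Suc j) = t * gain w N j + t * weight (Suc j) * (exp D - 1)"
    unfolding gain_def Phi_tilde_L_tilde[OF w(1) jm(1)] Phi_tilde_L_tilde[OF w(1) jm(2)]
    by (simp add: D_def algebra_simps)
  also have "\<dots> = t * gain w N j + r (Suc j) * exp (- a) * (exp D - 1)"
    unfolding weight_eq[OF jm(2)] a_def ..
  also have "\<dots> \<le> r j * (C * exp u) + r (Suc j) * exp (- a) * (exp D - 1)"
    using IH by simp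
  also have "\<dots> \<le> r (Suc j) * exp (- a) * (C * exp u) + r (Suc j) * exp (- a) * (exp D - 1)"
    using r_pred_le[OF jm(2)] C_ge_1 unfolding a_def
    by (intro add_right_mono mult_right_mono) auto
  \<comment> \<open>With \<open>x = C * exp u\<close> and \<open>y = exp D\<close>, both at least 1:
    \<open>x + y - 1 = x * y - (x - 1) * (y - 1)\<close>.\<close>
  also have "\<dots> = r (Suc j) * exp (- a) * (C * exp u * exp D - (C * exp u - 1) * (exp D - 1))"
    by (simp add: algebra_simps)
  also have "\<dots> \<le> r (Suc j) * exp (- a) * (C * exp u * exp D)"
    using nonneg r_pos[OF jm(2)] by (intro mult_left_mono) auto
  also have "\<dots> = r (Suc j) * C * exp (u + D - a)"
    by (simp add: exp_diff exp_add exp_minus field_simps)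
  also have "u + D - a = L_tilde k \<alpha> w (Suc j) - L \<alpha> (Suc j) + w / real k"
    unfolding u_def D_def a_def L_Suc by simp
  finally show ?case .
qed

lemma ex_interval_grid:
  assumes "0 \<le> w" "real N \<le> L_tilde k \<alpha> w j * real k - 1"
  obtains l where "1 \<le> l" "l \<le> j" "L_tilde k \<alpha> w (l - 1) \<le> real N / real k"
    "real N / real k < L_tilde k \<alpha> w l"
proof (rule ex_interval[OF assms(1)])
  show "0 \<le> real N / real k" by simp
  show "real N / real k < L_tilde k \<alpha> w j" using assms(2) k_pos by (simp add: divide_less_eq)
qed (rule that)

text \<open>The carried shift is at most \<open>1 / k\<close>, which costs the factor
  \<open>exp (1 / k)\<close> in the constant.\<close>

lemma gain_le:
  assumes w: "0 \<le> w" "w \<le> 1" and j: "j \<in> {1..m}"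
    and N: "real N \<le> L_tilde k \<alpha> w j * real k - 1"
  shows "gain w N j \<le> r j / (t / ((1 + real k) * (exp (1 / real k) - 1)))"
proof -
  obtain l where l: "1 \<le> l" "l \<le> j" "L_tilde k \<alpha> w (l - 1) \<le> real N / real k"
    "real N / real k < L_tilde k \<alpha> w l"
    using ex_interval_grid[OF w(1) N] .
  have "t * gain w N j \<le> r j * C * exp (L_tilde k \<alpha> w j - L \<alpha> j + w / real k)"
    using gain_le_shift[OF w l(1,2) _ l(3,4)] j by simp
  also have "\<dots> \<le> r j * C * exp (1 / real k)"
    using L_tilde_shift_bounds(2)[OF k w] r_pos[OF j] C_ge_1 by (intro mult_left_mono) auto
  finally have "t * gain w N j \<le> r j * ((1 + real k) * (exp (1 / real k) - 1))"
    by (simp add: C_exp mult.assoc)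
  then show ?thesis using t_pos by (simp add: pos_le_divide_eq mult.commute)
qed

text \<open>With one price the limits are 0 and 1 and incur no rounding error, so the base interval
  already gives the bound with \<open>C\<close>.\<close>

lemma gain_le_single:
  assumes "m = 1" and w: "0 \<le> w" and j: "j \<in> {1..m}"
    and N: "real N \<le> L_tilde k \<alpha> w j * real k - 1"
  shows "gain w N j \<le> r j / (t / ((1 + real k) * (1 - exp (- (1 / real k)))))"
proof -
  obtain l where l: "1 \<le> l" "l \<le> j" "L_tilde k \<alpha> w (l - 1) \<le> real N / real k"
    "real N / real k < L_tilde k \<alpha> w l"
    using ex_interval_grid[OF w N] .
  have [simp]: "j = 1" "l = 1" using j l \<open>m = 1\<close> by auto
  have "L_tilde k \<alpha> w 1 - L_tilde k \<alpha> w 0 - \<alpha> 1 = 0"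
    using L_tilde_0[OF w] L_tilde_m[OF w] L_m \<open>m = 1\<close> by (simp add: L_def)
  then have "t * gain w N j \<le> r j * C"
    using gain_base[OF w _ l(3,4)] m by simp
  then show ?thesis using t_pos unfolding C_def by (simp add: pos_le_divide_eq mult.commute)
qed

end

section \<open>The uniform seed and Jensen's inequality\<close>

interpretation seed: prob_space seed
  unfolding seed_def by (rule prob_space_uniform_measure) auto

lemma sets_seed [measurable_cong]: "sets seed = sets borel"
  by (simp add: seed_def)

lemma AE_seed: "AE w in seed. 0 \<le> w \<and> w \<le> 1"
  unfolding seed_def by (rule AE_uniform_measureI) auto

lemma measure_seed_lessThan:
  assumes "0 \<le> x" "x \<le> 1"
  shows "measure seed {..<x} = x"
proof -
  have "{0..1} \<inter> {..<x} = {0..<x}" using assms by auto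
  then show ?thesis
    unfolding seed_def using assms by (subst measure_uniform_measure) auto
qed

lemma L_tilde_measurable [measurable]: "(\<lambda>w. L_tilde k \<alpha> w j) \<in> borel_measurable borel"
  unfolding L_tilde_eq by measurable

lemma L_tilde_bounds:
  "\<bar>L_tilde k \<alpha> w j\<bar> \<le> (\<bar>of_int \<lfloor>L \<alpha> j * real k\<rfloor>\<bar> + 1) / real k"
  unfolding L_tilde_eq abs_divide
  by (auto intro!: divide_right_mono simp: indicator_def)

lemma integrable_L_tilde: "integrable seed (\<lambda>w. L_tilde k \<alpha> w j)"
  by (rule seed.integrable_const_bound[OF AE_I2])
    (use L_tilde_bounds[of k \<alpha> _ j] in auto)

lemma integrable_exp_L_tilde_diff:
  "integrable seed (\<lambda>w. exp (L_tilde k \<alpha> w i - L_tilde k \<alpha> w j))"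
proof (rule seed.integrable_const_bound[OF AE_I2])
  fix w
  show "norm (exp (L_tilde k \<alpha> w i - L_tilde k \<alpha> w j))
      \<le> exp ((\<bar>of_int \<lfloor>L \<alpha> i * real k\<rfloor>\<bar> + 1) / real k + (\<bar>of_int \<lfloor>L \<alpha> j * real k\<rfloor>\<bar> + 1) / real k)"
    using L_tilde_bounds[of k \<alpha> w i] L_tilde_bounds[of k \<alpha> w j] by simp
qed simp

text \<open>The rounding is unbiased: the seed lies below \<open>frac ?a\<close> with exactly that
  probability.\<close>

lemma expectation_L_tilde:
  assumes "k \<ge> 1"
  shows "seed.expectation (\<lambda>w. L_tilde k \<alpha> w j) = L \<alpha> j"
proof -
  let ?a = "L \<alpha> j * real k"
  have "seed.expectation (\<lambda>w. L_tilde k \<alpha> w j)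
      = (of_int \<lfloor>?a\<rfloor> + measure seed {..<frac ?a}) / real k"
    unfolding L_tilde_eq by (simp add: seed.prob_space seed.integrable_const_bound[where B = 1] sets_seed)
  also have "measure seed {..<frac ?a} = frac ?a"
    by (intro measure_seed_lessThan) (auto intro: less_imp_le[OF frac_lt_1])
  finally show ?thesis using assms by (simp add: frac_def)
qed

text \<open>The tangent of \<open>exp\<close> at the mean \<open>?d\<close> lies below
  \<open>exp\<close>, and its expectation along \<open>?X\<close> is \<open>exp ?d\<close>.\<close>

lemma expectation_exp_L_tilde_ge:
  assumes "k \<ge> 1"
  shows "exp (L \<alpha> i - L \<alpha> j)
    \<le> seed.expectation (\<lambda>w. exp (L_tilde k \<alpha> w i - L_tilde k \<alpha> w j))"
proof -
  let ?d = "L \<alpha> i - L \<alpha> j"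
  let ?X = "\<lambda>w. L_tilde k \<alpha> w i - L_tilde k \<alpha> w j"
  have "seed.expectation (\<lambda>w. exp ?d * (1 + (?X w - ?d))) = exp ?d"
    by (simp add: integrable_L_tilde expectation_L_tilde[OF assms] seed.prob_space)
  moreover have "seed.expectation (\<lambda>w. exp ?d * (1 + (?X w - ?d))) \<le> seed.expectation (\<lambda>w. exp (?X w))"
  proof (rule integral_mono)
    fix w
    have "exp ?d * (1 + (?X w - ?d)) \<le> exp ?d * exp (?X w - ?d)"
      by (intro mult_left_mono exp_ge_add_one_self) simp
    then show "exp ?d * (1 + (?X w - ?d)) \<le> exp (?X w)" by (simp flip: exp_add)
  qed (simp_all add: integrable_L_tilde integrable_exp_L_tilde_diff)
  ultimately show ?thesis by simp
qed

section \<open>Expectation bound and assembly of the two conditions\<close>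

context booking
begin

text \<open>Jensen is applied interval by interval; \<open>weight i\<close> is normalised so that
  the unrounded increments are \<open>r i - r (i - 1)\<close>, and these telescope to
  \<open>r j\<close>.\<close>

lemma expectation_Phi_tilde_ge:
  assumes j: "j \<in> {1..m}"
  shows "r j \<le> seed.expectation (\<lambda>w. Phi_tilde k m r \<alpha> w (L_tilde k \<alpha> w j))"
proof -
  define f where "f = (\<lambda>w. Phi_tilde k m r \<alpha> w (L_tilde k \<alpha> w j))"
  define g where "g = (\<lambda>w. \<Sum>i=1..j.
    weight i * (exp (L_tilde k \<alpha> w i - L_tilde k \<alpha> w (i - 1)) - 1))"
  have g_meas [measurable]: "g \<in> borel_measurable borel" unfolding g_def by measurable
  \<comment> \<open>Measurability concerns all real seeds: for \<open>w < 0\<close> every limit is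
    rounded up, so \<open>f\<close> is constant there, with -1 as representative.\<close>
  have f_eq: "f w = (if w < 0 then f (-1) else g w)" for w
  proof (cases "w < 0")
    case True
    then have "L_tilde k \<alpha> w = L_tilde k \<alpha> (-1)"
      by (auto simp: L_tilde_eq fun_eq_iff indicator_def) (smt (verit) frac_ge_0)+
    then show ?thesis using True Phi_tilde_cong[of k \<alpha> w "-1" m r] by (simp add: f_def)
  next
    case False
    then show ?thesis using Phi_tilde_L_tilde[of w j] j by (simp add: f_def g_def)
  qed
  have "(\<lambda>w. if w < 0 then f (-1) else g w) \<in> borel_measurable borel" by measurable
  moreover have "(\<lambda>w. if w < 0 then f (-1) else g w) = f" by (rule ext) (rule f_eq[symmetric])
  ultimately have f_meas: "f \<in> borel_measurable borel" by simp
  have "seed.expectation f = seed.expectation g"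
  proof (rule integral_cong_AE)
    show "AE w in seed. f w = g w" using AE_seed by eventually_elim (rule trans[OF f_eq], simp)
  qed (use f_meas g_meas in measurable)
  moreover have "seed.expectation g = (\<Sum>i=1..j. weight i *
      (seed.expectation (\<lambda>w. exp (L_tilde k \<alpha> w i - L_tilde k \<alpha> w (i - 1))) - 1))"
    unfolding g_def by (simp add: integrable_exp_L_tilde_diff seed.prob_space)
  moreover have "(\<Sum>i=1..j. r i - r (i - 1)) \<le> \<dots>"
  proof (rule sum_mono)
    fix i assume "i \<in> {1..j}"
    then have i: "i \<in> {1..m}" using j by auto
    have "\<alpha> i = L \<alpha> i - L \<alpha> (i - 1)" using L_Suc[of \<alpha> "i - 1"] i by simp
    then have "exp (\<alpha> i) - 1
        \<le> seed.expectation (\<lambda>w. exp (L_tilde k \<alpha> w i - L_tilde k \<alpha> w (i - 1))) - 1"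
      using expectation_exp_L_tilde_ge[OF k] by simp
    then have "weight i * (exp (\<alpha> i) - 1) \<le> weight i *
        (seed.expectation (\<lambda>w. exp (L_tilde k \<alpha> w i - L_tilde k \<alpha> w (i - 1))) - 1)"
      using weight_nonneg[OF i] by (rule mult_left_mono)
    moreover have "weight i * (exp (\<alpha> i) - 1) = r i - r (i - 1)"
      using \<alpha>_pos[OF i] by (simp add: weight_def)
    ultimately show "r i - r (i - 1) \<le> weight i *
        (seed.expectation (\<lambda>w. exp (L_tilde k \<alpha> w i - L_tilde k \<alpha> w (i - 1))) - 1)" by simp
  qed
  moreover have "(\<Sum>i=1..j. r i - r (i - 1)) = r j"
    by (induction j) (simp_all add: r_0)
  ultimately show ?thesis unfolding f_def by simp
qed

text \<open>Both values of \<open>c\<close> share the expectation bound, so only the gain bound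
  remains, on the almost sure range of the seed.\<close>

lemma value_function_conditionsI:
  assumes "\<And>w j N. \<lbrakk>0 \<le> w; w \<le> 1; j \<in> {1..m}; real N \<le> L_tilde k \<alpha> w j * real k - 1\<rbrakk>
    \<Longrightarrow> gain w N j \<le> r j / c"
  shows "value_function_conditions k m r \<alpha> c"
  unfolding value_function_conditions_def
proof
  show "AE w in seed. \<forall>j\<in>{1..m}. \<forall>N::nat. real N \<le> L_tilde k \<alpha> w j * real k - 1 \<longrightarrow>
      real k * (Phi_tilde k m r \<alpha> w (real (N + 1) / real k) - Phi_tilde k m r \<alpha> w (real N / real k))
      + Phi_tilde k m r \<alpha> w (L_tilde k \<alpha> w j) - Phi_tilde k m r \<alpha> w (real N / real k) \<le> r j / c"
    using AE_seed by eventually_elim (use assms in \<open>auto simp: gain_def\<close>)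
qed (use expectation_Phi_tilde_ge in blast)

end

theorem theorem5:
  fixes k m :: nat and r \<alpha> :: "nat \<Rightarrow> real"
  assumes "k \<ge> 1"
    and "price_set m r"
    and "booking_fractions m r \<alpha>"
  shows "value_function_conditions k m r \<alpha>
           ((1 - exp (- \<alpha> 1)) / ((1 + real k) * (exp (1 / real k) - 1)))
       \<and> (m = 1 \<longrightarrow> value_function_conditions k m r \<alpha>
           ((1 - exp (- \<alpha> 1)) / ((1 + real k) * (1 - exp (- (1 / real k))))))"
proof -
  interpret booking k m r \<alpha> using assms by unfold_locales
  show ?thesis
    using value_function_conditionsI gain_le gain_le_single by blast
qed

end
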